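(* Let $M,n,\hat R,d_z\ge1$ be integers, $N=Mn$, $\epsilon>0$, and let $K$ satisfy the Kernel Assumption of the context. Let $\hat\mu^i_n=\frac1n\sum_{k=1}^n\delta_{x^i_k}$ ($x^i_k\in\mathcal X^i$, $i\in[M]$) and $\hat\nu_n=\frac1n\sum_{\ell=1}^n\delta_{z_\ell}$ ($z_\ell\in\mathcal Z\subseteq\mathbb R^{d_z}$), let $W\in\mathbb R^{N\times N}$ be the empirical kernel matrix and $L\in\mathbb R^{N\times\hat R}$ the factor in its rank-$\hat R$ approximation $W\approx LL^\top$. For $\hat A\in\mathbb R^{\hat R\times d_z}$ put $$\hat C(\hat A)=2\,\Omega\,\hat Z_{\mathrm{norm}}^\top-4L\hat A\hat Z^\top\in\mathbb R^{N\times n},$$ and let $\hat C^i(\hat A)\in\mathbb R^{n\times n}$ be its $i$-th row block, i.e. rows $(i-1)n+1,\dots,in$. Then $$\hat S^{\hat R}_\epsilon(\{\hat\mu^i_n\}_{i=1}^M,\hat\nu_n)=\min_{\hat A\in\mathbb R^{\hat R\times d_z}}\Big\{2\|\hat A\|_F^2+\sum_{i=1}^M\mathrm{OT}^i_{\hat C^i(\hat A),\epsilon}(\hat\mu^i_n,\hat\nu_n)\Big\},$$ where $$\mathrm{OT}^i_{\hat C^i(\hat A),\epsilon}(\hat\mu^i_n,\hat\nu_n)=\min_{\hat\pi^i\in\Gamma(\hat\mu^i_n,\hat\nu_n)}\Big\{\langle\hat C^i(\hat A),\hat\pi^i\rangle+\epsilon D_{\mathrm{KL}}(\hat\pi^i\|\hat\mu^i_n\otimes\hat\nu_n)\Big\}.$$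 Moreover, for fixed transport plans $\{\hat\pi^i\}_{i=1}^M$ with $\hat\pi^i\in\Gamma(\hat\mu^i_n,\hat\nu_n)$, the matrix $\hat A$ minimizing $2\|\hat A\|_F^2+\sum_{i=1}^M\big(\langle\hat C^i(\hat A),\hat\pi^i\rangle+\epsilon D_{\mathrm{KL}}(\hat\pi^i\|\hat\mu^i_n\otimes\hat\nu_n)\big)$ satisfies $\hat A=L^\top\hat\Pi\hat Z$.
   Context: Setting. $[M]=\{1,\dots,M\}$; $\mathcal X^i$ are feature spaces (subsets of Euclidean spaces), $\mathcal X=\bigsqcup_{i=1}^M\mathcal X^i$. Kernel Assumption. $K:\mathcal X\times\mathcal X\to\mathbb R_{\ge0}$ is symmetric positive semidefinite and, with $\rho=\frac1M\sum_i\mu^i$ for underlying modality distributions $\mu^i\in\mathcal P(\mathcal X^i)$, admits a Mercer decomposition $K(x,x')=\sum_{r\ge1}\phi_r(x)\phi_r(x')$ for all $x,x'$, where $\phi_r=\sqrt{\lambda_r}\phi'_r$, $\lambda_r\ge0$, and $\{\phi'_r\}$ are $L^2(\rho)$-orthonormal eigenfunctions (eigenvalues $\lambda_r$) of $f\mapsto\int K(\cdot,x')f(x')\,d\rho(x')$; moreover $\sup_xK(x,x)\le\kappa^2<\infty$ and $\eta_R:=\sup_x\sum_{r>R}\phi_r(x)^2\to0$ as $R\to\infty$. Discrete notation. $\Gamma(\hat\mu^i_n,\hat\nu_n)$ is identified with the set of matrices $\hat\pi^i\in\mathbb R^{n\times n}_+$ with $\hat\pi^i\mathbf 1=\frac1n\mathbf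 1$ and $\hat\pi^{i\top}\mathbf 1=\frac1n\mathbf 1$ ($\hat\pi^i_{k\ell}$ is the mass sent from $x^i_k$ to $z_\ell$); the product $\hat\mu^i_n\otimes\hat\nu_n$ is the matrix with all entries $1/n^2$, and $D_{\mathrm{KL}}$ is the Kullback–Leibler divergence. $\langle\cdot,\cdot\rangle$ on matrices is the Frobenius inner product. $W$ is the $M\times M$ block matrix with $n\times n$ blocks $W^{i,j}_{k,k'}=K(x^i_k,x^j_{k'})$; rows and columns of $N\times N$ matrices are indexed by pairs $(i,k)\leftrightarrow(i-1)n+k$, and $(LL^\top)^{i,j}_{k,k'}$ is the corresponding entry of $LL^\top$. The factor $L\in\mathbb R^{N\times\hat R}$ comes from a pivoted Cholesky (Nyström-type) factorization of $W$, so that $W-LL^\top\succeq0$. $\hat\Pi\in\mathbb R^{N\times n}$ is the vertical stacking of $\hat\pi^1,\dots,\hat\pi^M$; $\hat Z\in\mathbb R^{n\times d_z}$ has $\ell$-th row $z_\ell^\top$; $\hat Z_{\mathrm{norm}}=(\|z_1\|^2,\dots,\|z_n\|^2)^\top$; $\Omega=\frac1nL(L^\top\mathbf 1_N)\in\mathbb R^N$. Low-rank empirical objective. $$\hat S^{\hat R}_\epsilon(\{\hat\mu^i_n\},\hat\nu_n)=\min_{\hat\pi^i\in\Gamma(\hat\mu^i_n,\hat\nu_n),\,i\in[M]}\ \sum_{i,j=1}^M\sum_{k,k',\ell,\ell'=1}^n(LL^\top)^{i,j}_{k,k'}\,\hat\pi^i_{k,\ell}\,\hat\pi^j_{k',\ell'}\,\|z_\ell-z_{\ell'}\|^2+\epsilon\sum_{i=1}^MD_{\mathrm{KL}}(\hat\pi^i\|\hat\mu^i_n\otimes\hat\nu_n).$$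 *)

theory Defs
  imports "HOL-Analysis.Analysis" "HOL-Probability.Probability"
begin

section \<open>Feature spaces, modality distributions and their mixture\<close>

text \<open>
  The modalities are the elements of a finite type \<open>'m\<close>, so \<open>M = CARD('m)\<close>. The feature space of
  modality \<open>i\<close> lies in a Euclidean space whose dimension may depend on \<open>i\<close>; a point of
  \<open>\<real>^d\<close> is therefore an extensional function on \<open>{..<d}\<close>. Points of the disjoint union of
  the feature spaces are pairs \<open>(i, x)\<close>.
\<close>

type_synonym 'm point = "'m \<times> (nat \<Rightarrow> real)"

definition euclid :: "nat \<Rightarrow> (nat \<Rightarrow> real) measure" where
  "euclid d = (\<Pi>\<^sub>M j\<in>{..<d}. (borel :: real measure))"

definition feature_space :: "nat \<Rightarrow> (nat \<Rightarrow> real) set \<Rightarrow> bool" where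
  "feature_space d X \<longleftrightarrow> X \<subseteq> space (euclid d)"

text \<open>Probability measures on the Borel sets of the subspace \<open>X\<close> (which need not be a Borel set).\<close>

definition distribution_on :: "nat \<Rightarrow> (nat \<Rightarrow> real) set \<Rightarrow> (nat \<Rightarrow> real) measure \<Rightarrow> bool" where
  "distribution_on d X \<mu> \<longleftrightarrow> prob_space \<mu> \<and> sets \<mu> = sets (restrict_space (euclid d) X)"

text \<open>\<open>\<rho> = 1/M \<Sum>\<^sub>i \<mu>\<^sup>i\<close> on the disjoint union.\<close>

definition modality_mixture :: "('m::finite \<Rightarrow> 'a measure) \<Rightarrow> ('m \<times> 'a) measure" where
  "modality_mixture \<mu> = measure_of (SIGMA i:UNIV. space (\<mu> i))
     {A. A \<subseteq> (SIGMA i:UNIV. space (\<mu> i)) \<and> (\<forall>i. Pair i -` A \<in> sets (\<mu> i))}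
     (\<lambda>A. (\<Sum>i\<in>UNIV. emeasure (\<mu> i) (Pair i -` A)) / of_nat CARD('m))"

section \<open>The kernel assumption\<close>

definition psd_kernel_on :: "'a set \<Rightarrow> ('a \<Rightarrow> 'a \<Rightarrow> real) \<Rightarrow> bool" where
  "psd_kernel_on S K \<longleftrightarrow>
     (\<forall>x\<in>S. \<forall>y\<in>S. K x y = K y x) \<and>
     (\<forall>(n::nat) p c. (\<forall>a<n. p a \<in> S) \<longrightarrow> 0 \<le> (\<Sum>a<n. \<Sum>b<n. c a * c b * K (p a) (p b)))"

text \<open>
  \<open>mercer_features \<rho> K \<phi>\<close>: the \<open>\<phi> r = sqrt (\<lambda> r) * \<psi> r\<close> are the scaled eigenfunctions of a Mercer
  decomposition of \<open>K\<close>. Indices start at \<open>0\<close>. Orthonormality is required on an index set \<open>I\<close> only,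
  with \<open>\<lambda> r = 0\<close> outside \<open>I\<close>, because \<open>L\<^sup>2(\<rho>)\<close> may be finite-dimensional, in which case it contains
  no infinite orthonormal family and the expansion is a finite sum padded with zeros. The
  eigenfunction equation is an identity in \<open>L\<^sup>2(\<rho>)\<close>; the expansion of \<open>K\<close> holds pointwise.
\<close>

definition mercer_features ::
  "'a measure \<Rightarrow> ('a \<Rightarrow> 'a \<Rightarrow> real) \<Rightarrow> (nat \<Rightarrow> 'a \<Rightarrow> real) \<Rightarrow> bool" where
  "mercer_features \<rho> K \<phi> \<longleftrightarrow> (\<exists>(I :: nat set) (ev :: nat \<Rightarrow> real) \<psi>.
     (\<forall>r. 0 \<le> ev r) \<and> (\<forall>r. r \<notin> I \<longrightarrow> ev r = 0) \<and>
     (\<forall>r x. \<phi> r x = sqrt (ev r) * \<psi> r x) \<and>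
     (\<forall>r\<in>I. \<psi> r \<in> borel_measurable \<rho> \<and> integrable \<rho> (\<lambda>x. (\<psi> r x)\<^sup>2)) \<and>
     (\<forall>r\<in>I. \<forall>s\<in>I. (\<integral>x. \<psi> r x * \<psi> s x \<partial>\<rho>) = (if r = s then 1 else 0)) \<and>
     (\<forall>r\<in>I. AE x in \<rho>. (\<integral>y. K x y * \<psi> r y \<partial>\<rho>) = ev r * \<psi> r x) \<and>
     (\<forall>x\<in>space \<rho>. \<forall>y\<in>space \<rho>. (\<lambda>r. \<phi> r x * \<phi> r y) sums K x y))"

definition kernel_assumption ::
  "('m::finite \<Rightarrow> (nat \<Rightarrow> real) set) \<Rightarrow> ('m \<Rightarrow> (nat \<Rightarrow> real) measure) \<Rightarrow>
   ('m point \<Rightarrow> 'm point \<Rightarrow> real) \<Rightarrow> bool" where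
  "kernel_assumption X \<mu> K \<longleftrightarrow>
     (\<forall>p\<in>Sigma UNIV X. \<forall>q\<in>Sigma UNIV X. 0 \<le> K p q) \<and>
     psd_kernel_on (Sigma UNIV X) K \<and>
     (\<exists>\<kappa>. \<forall>p\<in>Sigma UNIV X. K p p \<le> \<kappa>\<^sup>2) \<and>
     (\<exists>\<phi>. mercer_features (modality_mixture \<mu>) K \<phi> \<and>
          (\<lambda>R. SUP p\<in>Sigma UNIV X. \<Sum>r. (\<phi> (r + R) p)\<^sup>2) \<longlonglongrightarrow> 0)"

section \<open>The empirical kernel matrix and its pivoted Cholesky factor\<close>

text \<open>
  The \<open>n\<close> samples are indexed by a finite type \<open>'n\<close>; the index \<open>(i - 1) n + k\<close> of an \<open>N \<times> N\<close> matrix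
  is the pair \<open>(i, k) :: 'm \<times> 'n\<close>.
\<close>

definition kernel_matrix ::
  "('m point \<Rightarrow> 'm point \<Rightarrow> real) \<Rightarrow> ('m::finite \<Rightarrow> 'n::finite \<Rightarrow> nat \<Rightarrow> real) \<Rightarrow>
   real^('m \<times> 'n)^('m \<times> 'n)" where
  "kernel_matrix K x = (\<chi> p q. K (fst p, x (fst p) (snd p)) (fst q, x (fst q) (snd q)))"

text \<open>
  One Cholesky step with pivot \<open>p\<close> subtracts the outer square of the normalised residual column.
  If the residual matrix \<open>D\<close> is positive semidefinite and \<open>D $ p $ p = 0\<close>, the whole column vanishes;
  since \<open>x / 0 = 0\<close>, the step then contributes a zero column.
\<close>

definition pivot_column :: "real^'a^'a \<Rightarrow> 'a \<Rightarrow> real^'a" where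
  "pivot_column D p = (\<chi> a. D $ a $ p / sqrt (D $ p $ p))"

definition cholesky_step :: "real^'a^'a \<Rightarrow> 'a \<Rightarrow> real^'a^'a" where
  "cholesky_step D p = (\<chi> a b. D $ a $ b - pivot_column D p $ a * pivot_column D p $ b)"

fun cholesky_columns :: "real^'a^'a \<Rightarrow> 'a list \<Rightarrow> (real^'a) list" where
  "cholesky_columns D [] = []"
| "cholesky_columns D (p # ps) = pivot_column D p # cholesky_columns (cholesky_step D p) ps"

text \<open>
  No pivoting rule (greedy, randomised, ...) is imposed: any pivot sequence \<open>ps\<close> is allowed. The list
  \<open>rs\<close> enumerates the columns of the factor in the order in which they are computed.
\<close>

definition pivoted_cholesky_factor :: "real^'a^'a \<Rightarrow> real^'r^'a \<Rightarrow> bool" where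
  "pivoted_cholesky_factor W L \<longleftrightarrow>
     (\<exists>ps rs. distinct rs \<and> set rs = (UNIV :: 'r set) \<and> length ps = length rs \<and>
        (\<forall>t<length rs. column (rs ! t) L = cholesky_columns W ps ! t))"

section \<open>Discrete optimal transport\<close>

definition couplings :: "(real^'n^'n) set" where
  "couplings = {P. (\<forall>k l. 0 \<le> P $ k $ l) \<and>
                   (\<forall>k. (\<Sum>l\<in>UNIV. P $ k $ l) = 1 / real CARD('n)) \<and>
                   (\<forall>l. (\<Sum>k\<in>UNIV. P $ k $ l) = 1 / real CARD('n))}"

definition product_coupling :: "real^'n^'n" where
  "product_coupling = (\<chi> k l. 1 / (real CARD('n))\<^sup>2)"

definition matrix_measure :: "real^'n^'m \<Rightarrow> ('m \<times> 'n) measure" where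
  "matrix_measure P = point_measure UNIV (\<lambda>(k, l). ennreal (P $ k $ l))"

text \<open>\<open>D\<^sub>K\<^sub>L(P \<parallel> Q)\<close> with the natural logarithm; the library takes the reference measure first.\<close>

definition kl_div :: "real^'n^'m \<Rightarrow> real^'n^'m \<Rightarrow> real" where
  "kl_div P Q = KL_divergence (exp 1) (matrix_measure Q) (matrix_measure P)"

text \<open>
  The values \<open>min\<close> are defined as infima; that they are attained is stated separately through
  \<open>has_minimum\<close>.
\<close>

definition has_minimum :: "('a \<Rightarrow> real) \<Rightarrow> 'a set \<Rightarrow> real \<Rightarrow> bool" where
  "has_minimum f S m \<longleftrightarrow> (\<exists>a\<in>S. f a = m) \<and> (\<forall>a\<in>S. m \<le> f a)"

text \<open>The matrix inner product \<open>\<bullet>\<close> is the Frobenius inner product.\<close>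

definition ot_objective :: "real^'n^'n \<Rightarrow> real \<Rightarrow> real^'n^'n \<Rightarrow> real" where
  "ot_objective C \<epsilon> P = C \<bullet> P + \<epsilon> * kl_div P product_coupling"

definition OT :: "real^'n^'n \<Rightarrow> real \<Rightarrow> real" where
  "OT C \<epsilon> = (INF P\<in>couplings. ot_objective C \<epsilon> P)"

section \<open>The low-rank objective\<close>

definition plans :: "('m \<Rightarrow> real^'n^'n) set" where
  "plans = {\<pi>. \<forall>i. \<pi> i \<in> couplings}"

definition lowrank_objective ::
  "real^'r^('m::finite \<times> 'n::finite) \<Rightarrow> ('n \<Rightarrow> real^'d) \<Rightarrow> real \<Rightarrow>
   ('m \<Rightarrow> real^'n^'n) \<Rightarrow> real" where
  "lowrank_objective L z \<epsilon> \<pi> =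
     (\<Sum>i\<in>UNIV. \<Sum>j\<in>UNIV. \<Sum>k\<in>UNIV. \<Sum>k'\<in>UNIV. \<Sum>l\<in>UNIV. \<Sum>l'\<in>UNIV.
        (L ** transpose L) $ (i, k) $ (j, k') * \<pi> i $ k $ l * \<pi> j $ k' $ l' * (norm (z l - z l'))\<^sup>2)
     + \<epsilon> * (\<Sum>i\<in>UNIV. kl_div (\<pi> i) product_coupling)"

definition lowrank_S :: "real^'r^('m::finite \<times> 'n::finite) \<Rightarrow> ('n \<Rightarrow> real^'d) \<Rightarrow> real \<Rightarrow> real" where
  "lowrank_S L z \<epsilon> = (INF \<pi>\<in>plans. lowrank_objective L z \<epsilon> \<pi>)"

definition Zhat :: "('n \<Rightarrow> real^'d) \<Rightarrow> real^'d^'n" where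
  "Zhat z = (\<chi> l. z l)"

definition Zhat_norm :: "('n \<Rightarrow> real^'d) \<Rightarrow> real^'n" where
  "Zhat_norm z = (\<chi> l. (norm (z l))\<^sup>2)"

definition Omega :: "real^'r^('m::finite \<times> 'n::finite) \<Rightarrow> real^('m \<times> 'n)" where
  "Omega L = (1 / real CARD('n)) *\<^sub>R (L *v (transpose L *v (\<chi> p. 1)))"

definition cost_matrix ::
  "real^'r^('m::finite \<times> 'n::finite) \<Rightarrow> ('n \<Rightarrow> real^'d) \<Rightarrow> real^'d^'r \<Rightarrow>
   real^'n^('m \<times> 'n)" where
  "cost_matrix L z A =
     2 *\<^sub>R (\<chi> p l. Omega L $ p * Zhat_norm z $ l) - 4 *\<^sub>R (L ** A ** transpose (Zhat z))"

definition row_block :: "real^'n^('m::finite \<times> 'n::finite) \<Rightarrow> 'm \<Rightarrow> real^'n^'n" where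
  "row_block C i = (\<chi> k. C $ (i, k))"

definition stack :: "('m \<Rightarrow> real^'n^'n) \<Rightarrow> real^'n^('m::finite \<times> 'n::finite)" where
  "stack \<pi> = (\<chi> p. \<pi> (fst p) $ snd p)"

section \<open>Consistency of the definitions\<close>

lemma
  fixes \<mu> :: "'m::finite \<Rightarrow> 'a measure"
  shows space_modality_mixture: "space (modality_mixture \<mu>) = (SIGMA i:UNIV. space (\<mu> i))"
    and sets_modality_mixture: "sets (modality_mixture \<mu>) =
      {A. A \<subseteq> (SIGMA i:UNIV. space (\<mu> i)) \<and> (\<forall>i. Pair i -` A \<in> sets (\<mu> i))}"
    and emeasure_modality_mixture: "A \<in> sets (modality_mixture \<mu>) \<Longrightarrow>
      emeasure (modality_mixture \<mu>) A =
        (\<Sum>i\<in>UNIV. emeasure (\<mu> i) (Pair i -` A)) / of_nat CARD('m)"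
proof -
  let ?\<Omega> = "SIGMA i:UNIV. space (\<mu> i)"
  let ?S = "{A. A \<subseteq> ?\<Omega> \<and> (\<forall>i. Pair i -` A \<in> sets (\<mu> i))}"
  have sa: "sigma_algebra ?\<Omega> ?S"
    unfolding sigma_algebra_iff2
  proof (intro conjI ballI allI impI)
    show "?S \<subseteq> Pow ?\<Omega>" by auto
    show "{} \<in> ?S" by auto
  next
    fix A assume A: "A \<in> ?S"
    have "Pair i -` (?\<Omega> - A) = space (\<mu> i) - Pair i -` A" for i by auto
    with A show "?\<Omega> - A \<in> ?S" by auto
  next
    fix F :: "nat \<Rightarrow> _" assume "range F \<subseteq> ?S"
    then have F: "F n \<subseteq> ?\<Omega>" "Pair i -` F n \<in> sets (\<mu> i)" for n i by blast+
    have "Pair i -` (\<Union>n. F n) \<in> sets (\<mu> i)" for i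
      unfolding vimage_UN using F by blast
    with F show "(\<Union>n. F n) \<in> ?S" by blast
  qed
  show 1: "space (modality_mixture \<mu>) = ?\<Omega>"
    unfolding modality_mixture_def by (rule space_measure_of) auto
  show 2: "sets (modality_mixture \<mu>) = ?S"
    unfolding modality_mixture_def using sa by (rule sigma_algebra.sets_measure_of_eq)
  show "emeasure (modality_mixture \<mu>) A =
      (\<Sum>i\<in>UNIV. emeasure (\<mu> i) (Pair i -` A)) / of_nat CARD('m)"
    if "A \<in> sets (modality_mixture \<mu>)"
    unfolding modality_mixture_def
  proof (rule emeasure_measure_of_sigma[OF sa])
    show "A \<in> ?S" using that 2 by simp
    let ?f = "\<lambda>A. (\<Sum>i\<in>UNIV. emeasure (\<mu> i) (Pair i -` A)) / of_nat CARD('m)"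
    show "positive ?S ?f" by (simp add: positive_def)
    show "countably_additive ?S ?f"
    proof (rule countably_additiveI)
      fix F :: "nat \<Rightarrow> _" assume F: "range F \<subseteq> ?S" "disjoint_family F"
      have "(\<Sum>n. emeasure (\<mu> i) (Pair i -` F n)) = emeasure (\<mu> i) (Pair i -` (\<Union>n. F n))" for i
        unfolding vimage_UN
      proof (rule suminf_emeasure)
        show "range (\<lambda>n. Pair i -` F n) \<subseteq> sets (\<mu> i)" using F(1) by blast
        show "disjoint_family (\<lambda>n. Pair i -` F n)"
          using F(2) unfolding disjoint_family_on_def by blast
      qed
      then show "(\<Sum>n. ?f (F n)) = ?f (\<Union>n. F n)"
        by (simp add: divide_ennreal_def suminf_sum)
    qed
  qed
qed

lemma prob_space_modality_mixture:
  fixes \<mu> :: "'m::finite \<Rightarrow> 'a measure"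
  assumes "\<And>i. prob_space (\<mu> i)"
  shows "prob_space (modality_mixture \<mu>)"
proof (rule prob_spaceI)
  let ?\<Omega> = "SIGMA i:UNIV. space (\<mu> i)"
  have "Pair i -` ?\<Omega> = space (\<mu> i)" for i by auto
  moreover have "?\<Omega> \<in> sets (modality_mixture \<mu>)"
    using sets.top[of "modality_mixture \<mu>"] by (simp add: space_modality_mixture)
  ultimately have "emeasure (modality_mixture \<mu>) ?\<Omega> = of_nat CARD('m) / of_nat CARD('m)"
    by (simp add: emeasure_modality_mixture prob_space.emeasure_space_1[OF assms])
  also have "\<dots> = (1 :: ennreal)"
    by (rule ennreal_divide_self) (simp_all add: of_nat_less_top)
  finally show "emeasure (modality_mixture \<mu>) (space (modality_mixture \<mu>)) = 1"
    by (simp add: space_modality_mixture)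
qed

lemma kl_div_eq:
  fixes P Q :: "real^'n^'m"
  assumes "\<And>k l. 0 \<le> P $ k $ l" "\<And>k l. 0 < Q $ k $ l"
  shows "kl_div P Q = (\<Sum>k\<in>UNIV. \<Sum>l\<in>UNIV. P $ k $ l * ln (P $ k $ l / Q $ k $ l))"
proof -
  let ?M = "count_space (UNIV :: ('m \<times> 'n) set)"
  let ?p = "\<lambda>x. P $ fst x $ snd x" and ?q = "\<lambda>x. Q $ fst x $ snd x"
  interpret sigma_finite_measure ?M
    by (rule sigma_finite_measure_count_space_finite) simp
  have "KL_divergence (exp 1) (density ?M ?q) (density ?M ?p)
      = (\<integral>x. ?p x * log (exp 1) (?p x / ?q x) \<partial>?M)"
    using assms by (intro KL_density_density) (auto simp: less_le)
  also have "\<dots> = (\<Sum>x\<in>UNIV. ?p x * ln (?p x / ?q x))"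
    by (simp add: lebesgue_integral_count_space_finite log_def)
  also have "\<dots> = (\<Sum>k\<in>UNIV. \<Sum>l\<in>UNIV. P $ k $ l * ln (P $ k $ l / Q $ k $ l))"
    by (simp add: sum.cartesian_product case_prod_beta)
  finally show ?thesis
    by (simp only: kl_div_def matrix_measure_def point_measure_def case_prod_unfold)
qed

definition psd_matrix :: "real^'a^'a \<Rightarrow> bool" where
  "psd_matrix A \<longleftrightarrow> transpose A = A \<and> (\<forall>v. 0 \<le> v \<bullet> (A *v v))"

lemma quadratic_form: "v \<bullet> (A *v v) = (\<Sum>a\<in>UNIV. \<Sum>b\<in>UNIV. v $ a * v $ b * A $ a $ b)"
  for A :: "real^'a^'a"
  by (simp add: inner_vec_def matrix_vector_mult_def sum_distrib_left mult_ac)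

lemma psd_kernel_matrix:
  fixes x :: "'m::finite \<Rightarrow> 'n::finite \<Rightarrow> nat \<Rightarrow> real"
  assumes "kernel_assumption X \<mu> K" "\<And>i k. x i k \<in> X i"
  shows "psd_matrix (kernel_matrix K x)"
  unfolding psd_matrix_def
proof (intro conjI allI)
  let ?pt = "\<lambda>p. (fst p, x (fst p) (snd p))"
  let ?W = "kernel_matrix K x"
  have psd: "psd_kernel_on (Sigma UNIV X) K"
    using assms(1) by (simp add: kernel_assumption_def)
  have pt: "?pt p \<in> Sigma UNIV X" for p using assms(2) by simp
  show "transpose ?W = ?W"
    using psd pt by (simp add: vec_eq_iff transpose_def kernel_matrix_def psd_kernel_on_def)
  fix v
  obtain h where h: "bij_betw h {0..<CARD('m \<times> 'n)} (UNIV :: ('m \<times> 'n) set)"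
    using ex_bij_betw_nat_finite[of "UNIV :: ('m \<times> 'n) set"] by auto
  then have h: "bij_betw h {..<CARD('m \<times> 'n)} UNIV" by (simp add: lessThan_atLeast0)
  have "0 \<le> (\<Sum>a<CARD('m \<times> 'n). \<Sum>b<CARD('m \<times> 'n). v $ h a * v $ h b * K (?pt (h a)) (?pt (h b)))"
    using psd[unfolded psd_kernel_on_def, THEN conjunct2, rule_format,
        where n = "CARD('m \<times> 'n)" and p = "\<lambda>a. ?pt (h a)" and c = "\<lambda>a. v $ h a"] pt by blast
  also have "\<dots> = (\<Sum>p\<in>UNIV. \<Sum>q\<in>UNIV. v $ p * v $ q * K (?pt p) (?pt q))"
    by (subst sum.reindex_bij_betw[OF h], subst sum.reindex_bij_betw[OF h]) simp
  also have "\<dots> = v \<bullet> (?W *v v)"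
    by (simp add: quadratic_form kernel_matrix_def)
  finally show "0 \<le> v \<bullet> (?W *v v)" .
qed

lemma psd_cholesky_step:
  fixes D :: "real^'a^'a"
  assumes "psd_matrix D"
  shows "psd_matrix (cholesky_step D p)"
  unfolding psd_matrix_def
proof (intro conjI allI)
  have sym: "D $ a $ b = D $ b $ a" for a b
    using assms unfolding psd_matrix_def by (metis transpose_def vec_lambda_beta)
  have nn: "0 \<le> v \<bullet> (D *v v)" for v using assms by (simp add: psd_matrix_def)
  show "transpose (cholesky_step D p) = cholesky_step D p"
    using sym by (auto simp: vec_eq_iff transpose_def cholesky_step_def)
  fix v
  let ?d = "D $ p $ p" and ?e = "axis p 1 :: real^'a"
  let ?s = "v \<bullet> (D *v ?e)"
  have De: "(D *v ?e) $ a = D $ a $ p" for a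
    by (simp add: matrix_vector_mult_def axis_def if_distrib cong: if_cong)
  have ee: "?e \<bullet> (D *v ?e) = ?d" by (simp add: inner_axis' De)
  have ev: "?e \<bullet> (D *v v) = ?s"
  proof -
    have "?e \<bullet> (D *v v) = (\<Sum>a\<in>UNIV. D $ p $ a * v $ a)"
      by (simp only: inner_axis') (simp add: matrix_vector_mult_def)
    also have "\<dots> = (\<Sum>a\<in>UNIV. v $ a * D $ a $ p)"
      by (rule sum.cong[OF refl]) (subst sym, rule mult.commute)
    also have "\<dots> = ?s" by (simp only: inner_vec_def De inner_real_def)
    finally show ?thesis .
  qed
  have dn: "0 \<le> ?d" using nn[of ?e] ee by simp
  have col: "v \<bullet> pivot_column D p = ?s / sqrt ?d"
    by (simp add: inner_vec_def pivot_column_def De sum_divide_distrib)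
  have "cholesky_step D p *v v = D *v v - (v \<bullet> pivot_column D p) *\<^sub>R pivot_column D p"
    by (simp add: vec_eq_iff cholesky_step_def matrix_vector_mult_def inner_vec_def
        right_diff_distrib sum_subtractf sum_distrib_left mult_ac)
  then have eq: "v \<bullet> (cholesky_step D p *v v) = v \<bullet> (D *v v) - ?s\<^sup>2 / ?d"
    using dn by (simp add: inner_diff_right col power2_eq_square)
  show "0 \<le> v \<bullet> (cholesky_step D p *v v)"
  proof (cases "?d = 0")
    case True
    then show ?thesis using eq nn[of v] by simp
  next
    case False
    let ?w = "v - (?s / ?d) *\<^sub>R ?e"
    have "0 \<le> ?w \<bullet> (D *v ?w)" by (rule nn)
    also have "\<dots> = v \<bullet> (D *v v) - 2 * (?s / ?d) * ?s + (?s / ?d)\<^sup>2 * ?d"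
      by (simp add: matrix_vector_mult_diff_distrib matrix_vector_mult_scaleR inner_diff_left
          inner_diff_right ee ev power2_eq_square algebra_simps)
    also have "\<dots> = v \<bullet> (D *v v) - ?s\<^sup>2 / ?d"
      using False by (simp add: field_simps power2_eq_square)
    finally show ?thesis using eq by simp
  qed
qed

lemma length_cholesky_columns: "length (cholesky_columns D ps) = length ps"
  by (induction ps arbitrary: D) auto

lemma psd_cholesky_residual:
  fixes D :: "real^'a^'a"
  assumes "psd_matrix D"
  shows "psd_matrix (\<chi> a b. D $ a $ b -
    (\<Sum>t<length ps. cholesky_columns D ps ! t $ a * cholesky_columns D ps ! t $ b))"
  using assms
proof (induction ps arbitrary: D)
  case Nil
  then show ?case by simp
next
  case (Cons p ps)
  from Cons.IH[OF psd_cholesky_step[OF Cons.prems, of p]] show ?case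
    by (simp add: sum.lessThan_Suc_shift cholesky_step_def algebra_simps del: sum.lessThan_Suc)
qed

text \<open>The residual \<open>W - L L\<^sup>T\<close> is positive semidefinite.\<close>

lemma psd_pivoted_cholesky_residual:
  fixes W :: "real^'a^'a" and L :: "real^'r^'a"
  assumes "psd_matrix W" "pivoted_cholesky_factor W L"
  shows "psd_matrix (W - L ** transpose L)"
proof -
  obtain ps rs where rs: "distinct rs" "set rs = (UNIV :: 'r set)" "length ps = length rs"
    and L: "\<And>t. t < length rs \<Longrightarrow> column (rs ! t) L = cholesky_columns W ps ! t"
    using assms(2) by (auto simp: pivoted_cholesky_factor_def)
  have bij: "bij_betw ((!) rs) {..<length rs} UNIV"
    using bij_betw_nth[OF rs(1) refl refl] rs(2) by simp
  have "(L ** transpose L) $ a $ b =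
      (\<Sum>t<length ps. cholesky_columns W ps ! t $ a * cholesky_columns W ps ! t $ b)" for a b
  proof -
    have "(L ** transpose L) $ a $ b = (\<Sum>r\<in>UNIV. L $ a $ r * L $ b $ r)"
      by (simp add: matrix_matrix_mult_def transpose_def)
    also have "\<dots> = (\<Sum>t<length rs. L $ a $ (rs ! t) * L $ b $ (rs ! t))"
      by (rule sum.reindex_bij_betw[OF bij, symmetric])
    also have "\<dots> = (\<Sum>t<length rs. cholesky_columns W ps ! t $ a * cholesky_columns W ps ! t $ b)"
      by (rule sum.cong) (auto simp: L[symmetric] column_def)
    finally show ?thesis by (simp add: rs(3))
  qed
  then have "W - L ** transpose L = (\<chi> a b. W $ a $ b -
      (\<Sum>t<length ps. cholesky_columns W ps ! t $ a * cholesky_columns W ps ! t $ b))"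
    by (simp add: vec_eq_iff)
  then show ?thesis using psd_cholesky_residual[OF assms(1), of ps] by simp
qed

end

theory Submission
  imports Defs "HOL-Real_Asymp.Real_Asymp"
begin

text \<open>
  Write \<open>\<Pi>\<close> for the stacked plans and \<open>B \<pi> = L\<^sup>T \<Pi> Z\<close>. Expanding the pairwise cost
  \<open>\<parallel>z\<^sub>l - z\<^sub>l'\<parallel>\<^sup>2 = \<parallel>z\<^sub>l\<parallel>\<^sup>2 + \<parallel>z\<^sub>l'\<parallel>\<^sup>2 - 2 z\<^sub>l \<bullet> z\<^sub>l'\<close> splits the quadratic part of the low-rank
  objective into three sums. In the first two, one of the two plans occurs only through its row
  sums, which are \<open>1/n\<close> for every coupling; these sums are therefore linear in \<open>\<Pi>\<close>, and both are
  equal to \<open>\<langle>\<Omega> Z\<^sub>n\<^sub>o\<^sub>r\<^sub>m\<^sup>T, \<Pi>\<rangle>\<close> because \<open>L L\<^sup>T\<close> is symmetric. The third sum is the Gram form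
  \<open>-2 \<parallel>B \<pi>\<parallel>\<^sup>2\<close>, a concave term. On the other side, \<open>\<langle>L A Z\<^sup>T, \<Pi>\<rangle> = \<langle>A, B \<pi>\<rangle>\<close> by adjunction, so the
  objective in which \<open>A\<close> is a free variable contains \<open>2 \<parallel>A\<parallel>\<^sup>2 - 4 \<langle>A, B \<pi>\<rangle>\<close>. Completing the square
  gives the identity (\<open>joint_objective_complete_square\<close>) that carries the whole theorem: on couplings,

  \<open>joint objective (A, \<pi>) = low-rank objective (\<pi>) + 2 \<parallel>A - B \<pi>\<parallel>\<^sup>2\<close>.

  It shows at once that \<open>B \<pi>\<close> is the only minimiser in \<open>A\<close> for fixed \<open>\<pi>\<close>, and that minimising
  over \<open>A\<close> first gives back the low-rank objective. Minimising over \<open>\<pi>\<close> first gives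
  \<open>2 \<parallel>A\<parallel>\<^sup>2\<close> plus the sum of the optimal transport values, since for fixed \<open>A\<close> the joint objective
  is a sum of terms each depending on one plan only (\<open>has_minimum_joint_objective\<close>).

  All minima over plans are attained because the couplings form a compact polytope and the
  divergence from the product coupling is continuous on it, boundary included: \<open>t ln t\<close> tends to
  \<open>0\<close> as \<open>t\<close> decreases to \<open>0\<close>. The minimum over \<open>A\<close> is inherited: if \<open>\<pi>\<close> is optimal for
  the low-rank objective, then \<open>B \<pi>\<close> is optimal for the problem in \<open>A\<close>.
\<close>

section \<open>Adjoints for the Frobenius inner product\<close>

text \<open>
  Both sides are the same triple sum, taken in different orders. With its companion for the right
  factor, this adjunction moves \<open>L\<close> and \<open>Z\<close> from the cost matrix onto the plans.
\<close>

lemma inner_matrix_mult_left: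
  fixes A :: "real^'k::finite^'p::finite" and B :: "real^'q::finite^'k"
  shows "(A ** B) \<bullet> P = B \<bullet> (transpose A ** P)"
proof -
  have "(A ** B) \<bullet> P = (\<Sum>p\<in>UNIV. \<Sum>q\<in>UNIV. \<Sum>k\<in>UNIV. A $ p $ k * B $ k $ q * P $ p $ q)"
    by (simp add: inner_vec_def matrix_matrix_mult_def sum_distrib_right)
  also have "\<dots> = (\<Sum>p\<in>UNIV. \<Sum>k\<in>UNIV. \<Sum>q\<in>UNIV. A $ p $ k * B $ k $ q * P $ p $ q)"
    by (intro sum.cong refl sum.swap)
  also have "\<dots> = (\<Sum>k\<in>UNIV. \<Sum>p\<in>UNIV. \<Sum>q\<in>UNIV. A $ p $ k * B $ k $ q * P $ p $ q)"
    by (rule sum.swap)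
  also have "\<dots> = (\<Sum>k\<in>UNIV. \<Sum>q\<in>UNIV. \<Sum>p\<in>UNIV. A $ p $ k * B $ k $ q * P $ p $ q)"
    by (intro sum.cong refl sum.swap)
  also have "\<dots> = B \<bullet> (transpose A ** P)"
    by (simp add: inner_vec_def matrix_matrix_mult_def transpose_def sum_distrib_left mult_ac)
  finally show ?thesis .
qed

lemma inner_matrix_mult_right:
  fixes A :: "real^'k::finite^'p::finite" and B :: "real^'k^'q::finite"
  shows "(A ** transpose B) \<bullet> P = A \<bullet> (P ** B)"
proof -
  have "(A ** transpose B) \<bullet> P = (\<Sum>p\<in>UNIV. \<Sum>q\<in>UNIV. \<Sum>k\<in>UNIV. A $ p $ k * B $ q $ k * P $ p $ q)"
    by (simp add: inner_vec_def matrix_matrix_mult_def transpose_def sum_distrib_right)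
  also have "\<dots> = (\<Sum>p\<in>UNIV. \<Sum>k\<in>UNIV. \<Sum>q\<in>UNIV. A $ p $ k * B $ q $ k * P $ p $ q)"
    by (intro sum.cong refl sum.swap)
  also have "\<dots> = A \<bullet> (P ** B)"
    by (simp add: inner_vec_def matrix_matrix_mult_def sum_distrib_left mult_ac)
  finally show ?thesis .
qed

text \<open>
  Moving one factor \<open>L\<close> across the inner product turns the quadratic form of \<open>L L\<^sup>T\<close> into a squared
  norm of a matrix with as many rows as \<open>L\<close> has columns. This is where the factorisation of the
  kernel matrix enters.
\<close>

lemma gram_quadratic_form:
  fixes L :: "real^'r::finite^'p::finite" and Y :: "real^'d::finite^'p"
  shows "(\<Sum>p\<in>UNIV. \<Sum>q\<in>UNIV. (L ** transpose L) $ p $ q * (Y $ p \<bullet> Y $ q))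
    = (norm (transpose L ** Y))\<^sup>2"
proof -
  have "(norm (transpose L ** Y))\<^sup>2 = (transpose L ** Y) \<bullet> (transpose L ** Y)"
    by (rule power2_norm_eq_inner)
  also have "\<dots> = (L ** transpose L ** Y) \<bullet> Y"
    by (simp only: inner_matrix_mult_left[symmetric] matrix_mul_assoc[symmetric])
  also have "\<dots> = (\<Sum>p\<in>UNIV. (\<Sum>q\<in>UNIV. (L ** transpose L) $ p $ q *\<^sub>R Y $ q) \<bullet> Y $ p)"
  proof -
    have "((L ** transpose L) ** Y) $ p = (\<Sum>q\<in>UNIV. (L ** transpose L) $ p $ q *\<^sub>R Y $ q)" for p
      by (simp add: vec_eq_iff matrix_matrix_mult_def[of _ Y])
    then show ?thesis by (simp only: inner_vec_def[of "L ** transpose L ** Y"])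
  qed
  finally show ?thesis by (simp add: inner_sum_left inner_sum_right inner_commute)
qed

section \<open>Linearising the objective\<close>

text \<open>
  The plans of different modalities interact through this matrix only; it is the optimal value of
  the auxiliary variable \<open>A\<close> for given plans.
\<close>

definition latent :: "real^'r::finite^('m::finite \<times> 'n::finite) \<Rightarrow> ('n \<Rightarrow> real^'d::finite) \<Rightarrow>
    ('m \<Rightarrow> real^'n^'n) \<Rightarrow> real^'d^'r" where
  "latent L z \<pi> = transpose L ** stack \<pi> ** Zhat z"

text \<open>
  The function of both variables whose two iterated minima are the two sides of the reformulation.
\<close>

definition joint_objective :: "real^'r::finite^('m::finite \<times> 'n::finite) \<Rightarrow>
    ('n \<Rightarrow> real^'d::finite) \<Rightarrow> real \<Rightarrow> real^'d^'r \<Rightarrow> ('m \<Rightarrow> real^'n^'n) \<Rightarrow> real" where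
  "joint_objective L z \<epsilon> A \<pi> =
     2 * (norm A)\<^sup>2 + (\<Sum>i\<in>UNIV. ot_objective (row_block (cost_matrix L z A) i) \<epsilon> (\<pi> i))"

lemma stack_row_sum:
  fixes \<pi> :: "'m::finite \<Rightarrow> real^'n::finite^'n"
  assumes "\<pi> \<in> plans"
  shows "(\<Sum>l\<in>UNIV. stack \<pi> $ p $ l) = 1 / real CARD('n)"
  using assms by (simp add: plans_def couplings_def stack_def)

lemma sum_row_block_inner:
  fixes C :: "real^'n::finite^('m::finite \<times> 'n)"
  shows "(\<Sum>i\<in>UNIV. row_block C i \<bullet> \<pi> i) = C \<bullet> stack \<pi>"
proof -
  have "row_block C i \<bullet> \<pi> i = (\<Sum>k\<in>UNIV. C $ (i, k) \<bullet> \<pi> i $ k)" for i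
    unfolding inner_vec_def[of "row_block C i"] by (simp add: row_block_def)
  then have "(\<Sum>i\<in>UNIV. row_block C i \<bullet> \<pi> i)
      = (\<Sum>i\<in>UNIV. \<Sum>k\<in>UNIV. C $ (i, k) \<bullet> \<pi> i $ k)"
    by simp
  also have "\<dots> = C \<bullet> stack \<pi>"
    by (simp add: inner_vec_def[of C] stack_def sum.cartesian_product case_prod_beta)
  finally show ?thesis .
qed

text \<open>
  Adjunction isolates the dependence on \<open>A\<close> in a single inner product with the latent matrix, the
  form in which the square can be completed.
\<close>

lemma inner_cost_matrix:
  fixes L :: "real^'r::finite^('m::finite \<times> 'n::finite)" and z :: "'n \<Rightarrow> real^'d::finite"
  shows "cost_matrix L z A \<bullet> stack \<pi> =
    2 * (\<Sum>p\<in>UNIV. Omega L $ p * (\<Sum>l\<in>UNIV. stack \<pi> $ p $ l * (norm (z l))\<^sup>2))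
    - 4 * (A \<bullet> latent L z \<pi>)"
proof -
  have "(\<chi> p l. Omega L $ p * Zhat_norm z $ l) \<bullet> stack \<pi>
      = (\<Sum>p\<in>UNIV. Omega L $ p * (\<Sum>l\<in>UNIV. stack \<pi> $ p $ l * (norm (z l))\<^sup>2))"
    by (simp add: inner_vec_def Zhat_norm_def sum_distrib_left mult_ac)
  moreover have "(L ** A ** transpose (Zhat z)) \<bullet> stack \<pi> = A \<bullet> latent L z \<pi>"
    by (simp only: inner_matrix_mult_right[of "L ** A"] inner_matrix_mult_left[of L A]
        latent_def matrix_mul_assoc)
  ultimately show ?thesis
    by (simp add: cost_matrix_def inner_diff_left)
qed

text \<open>
  After the square is expanded, one of the two weights can be summed out in each of the two
  diagonal terms, leaving the common total mass \<open>s\<close>; the mixed term factors into the inner product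
  of the two weighted means.
\<close>

lemma pairwise_cost_expand:
  fixes a b :: "'n::finite \<Rightarrow> real" and z :: "'n \<Rightarrow> 'v::real_inner"
  assumes "(\<Sum>l\<in>UNIV. a l) = s" "(\<Sum>l\<in>UNIV. b l) = s"
  shows "(\<Sum>l\<in>UNIV. \<Sum>l'\<in>UNIV. a l * b l' * (norm (z l - z l'))\<^sup>2) =
    s * (\<Sum>l\<in>UNIV. a l * (norm (z l))\<^sup>2) + s * (\<Sum>l\<in>UNIV. b l * (norm (z l))\<^sup>2)
    - 2 * ((\<Sum>l\<in>UNIV. a l *\<^sub>R z l) \<bullet> (\<Sum>l\<in>UNIV. b l *\<^sub>R z l))"
proof -
  have sq: "a l * b l' * (norm (z l - z l'))\<^sup>2 =
      (a l * (norm (z l))\<^sup>2) * b l' + a l * (b l' * (norm (z l'))\<^sup>2)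
      - 2 * ((a l *\<^sub>R z l) \<bullet> (b l' *\<^sub>R z l'))" for l l'
    by (simp add: power2_norm_eq_inner inner_diff_left inner_diff_right inner_commute algebra_simps)
  have "(\<Sum>l\<in>UNIV. a l *\<^sub>R z l) \<bullet> (\<Sum>l\<in>UNIV. b l *\<^sub>R z l)
      = (\<Sum>l\<in>UNIV. \<Sum>l'\<in>UNIV. (a l *\<^sub>R z l) \<bullet> (b l' *\<^sub>R z l'))"
    by (simp only: inner_sum_left inner_sum_right) (rule sum.swap)
  then show ?thesis
    unfolding sq sum.distrib sum_subtractf
    by (simp only: sum_distrib_left[symmetric] sum_distrib_right[symmetric] assms mult.commute)
qed

text \<open>
  The row sums of a plan are \<open>1/n\<close>, so each of the two diagonal terms collapses to the pairing with
  \<open>\<Omega>\<close>, whose normalisation \<open>1/n\<close> comes from here. The mixed term is a Gram form in the rows of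
  \<open>\<Pi> Z\<close>.
\<close>

lemma quadratic_cost:
  fixes L :: "real^'r::finite^('m::finite \<times> 'n::finite)" and z :: "'n \<Rightarrow> real^'d::finite"
  assumes "\<pi> \<in> plans"
  shows "(\<Sum>p\<in>UNIV. \<Sum>q\<in>UNIV. (L ** transpose L) $ p $ q *
      (\<Sum>l\<in>UNIV. \<Sum>l'\<in>UNIV. stack \<pi> $ p $ l * stack \<pi> $ q $ l' * (norm (z l - z l'))\<^sup>2)) =
    2 * (\<Sum>p\<in>UNIV. Omega L $ p * (\<Sum>l\<in>UNIV. stack \<pi> $ p $ l * (norm (z l))\<^sup>2))
    - 2 * (norm (latent L z \<pi>))\<^sup>2"
proof -
  let ?W = "L ** transpose L" and ?n = "real CARD('n)"
  define h where "h p = (\<Sum>l\<in>UNIV. stack \<pi> $ p $ l * (norm (z l))\<^sup>2)" for p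
  define Y where "Y = stack \<pi> ** Zhat z"
  have Y: "(\<Sum>l\<in>UNIV. stack \<pi> $ p $ l *\<^sub>R z l) = Y $ p" for p
    by (simp add: Y_def vec_eq_iff matrix_matrix_mult_def Zhat_def)
  have sym: "?W $ p $ q = ?W $ q $ p" for p q
    by (simp add: matrix_matrix_mult_def transpose_def mult.commute)
  have Omega: "Omega L $ p = (\<Sum>q\<in>UNIV. ?W $ p $ q * (1 / ?n))" for p
    unfolding Omega_def matrix_vector_mul_assoc
    by (simp add: matrix_vector_mult_def sum_divide_distrib)
  have \<Omega>: "(\<Sum>p\<in>UNIV. \<Sum>q\<in>UNIV. ?W $ p $ q * (1 / ?n * h p)) = (\<Sum>p\<in>UNIV. Omega L $ p * h p)"
    by (simp only: Omega sum_distrib_right mult.assoc)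
  \<comment> \<open>Symmetry of \<open>L L\<^sup>T\<close> identifies the second diagonal term with the first.\<close>
  have "(\<Sum>p\<in>UNIV. \<Sum>q\<in>UNIV. ?W $ p $ q * (1 / ?n * h q))
      = (\<Sum>q\<in>UNIV. \<Sum>p\<in>UNIV. ?W $ q $ p * (1 / ?n * h q))"
    by (subst sum.swap) (simp only: sym)
  then have \<Omega>': "(\<Sum>p\<in>UNIV. \<Sum>q\<in>UNIV. ?W $ p $ q * (1 / ?n * h q)) = (\<Sum>p\<in>UNIV. Omega L $ p * h p)"
    using \<Omega> by simp
  have "(\<Sum>p\<in>UNIV. \<Sum>q\<in>UNIV. ?W $ p $ q *
      (\<Sum>l\<in>UNIV. \<Sum>l'\<in>UNIV. stack \<pi> $ p $ l * stack \<pi> $ q $ l' * (norm (z l - z l'))\<^sup>2))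
    = (\<Sum>p\<in>UNIV. \<Sum>q\<in>UNIV. ?W $ p $ q * (1 / ?n * h p + 1 / ?n * h q - 2 * (Y $ p \<bullet> Y $ q)))"
    by (simp only: pairwise_cost_expand[OF stack_row_sum[OF assms] stack_row_sum[OF assms]] h_def Y)
  also have "\<dots> = (\<Sum>p\<in>UNIV. \<Sum>q\<in>UNIV. ?W $ p $ q * (1 / ?n * h p))
      + (\<Sum>p\<in>UNIV. \<Sum>q\<in>UNIV. ?W $ p $ q * (1 / ?n * h q))
      - 2 * (\<Sum>p\<in>UNIV. \<Sum>q\<in>UNIV. ?W $ p $ q * (Y $ p \<bullet> Y $ q))"
    by (simp only: right_diff_distrib distrib_left sum.distrib sum_subtractf sum_distrib_left
        mult.left_commute[of _ "2::real"])
  also have "\<dots> = 2 * (\<Sum>p\<in>UNIV. Omega L $ p * h p) - 2 * (norm (transpose L ** Y))\<^sup>2"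
    by (simp only: \<Omega> \<Omega>' gram_quadratic_form)
  finally show ?thesis
    by (simp only: h_def latent_def Y_def matrix_mul_assoc)
qed

lemma lowrank_objective_stack:
  fixes L :: "real^'r::finite^('m::finite \<times> 'n::finite)" and z :: "'n \<Rightarrow> real^'d::finite"
  shows "lowrank_objective L z \<epsilon> \<pi> =
    (\<Sum>p\<in>UNIV. \<Sum>q\<in>UNIV. (L ** transpose L) $ p $ q *
      (\<Sum>l\<in>UNIV. \<Sum>l'\<in>UNIV. stack \<pi> $ p $ l * stack \<pi> $ q $ l' * (norm (z l - z l'))\<^sup>2))
    + \<epsilon> * (\<Sum>i\<in>UNIV. kl_div (\<pi> i) product_coupling)"
proof -
  let ?t = "\<lambda>i k j k'. (L ** transpose L) $ (i, k) $ (j, k') *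
    (\<Sum>l\<in>UNIV. \<Sum>l'\<in>UNIV. \<pi> i $ k $ l * \<pi> j $ k' $ l' * (norm (z l - z l'))\<^sup>2)"
  have pairs: "(\<Sum>p\<in>UNIV. f p) = (\<Sum>i\<in>UNIV. \<Sum>k\<in>UNIV. f (i, k))" for f :: "'m \<times> 'n \<Rightarrow> real"
    by (simp add: sum.cartesian_product)
  have "(\<Sum>i\<in>UNIV. \<Sum>k\<in>UNIV. \<Sum>j\<in>UNIV. \<Sum>k'\<in>UNIV. ?t i k j k')
      = (\<Sum>i\<in>UNIV. \<Sum>j\<in>UNIV. \<Sum>k\<in>UNIV. \<Sum>k'\<in>UNIV. ?t i k j k')"
    by (intro sum.cong refl sum.swap)
  then show ?thesis
    by (simp add: lowrank_objective_def pairs stack_def sum_distrib_left mult.assoc)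
qed

text \<open>
  The concave term \<open>-2 \<parallel>L\<^sup>T \<Pi> Z\<parallel>\<^sup>2\<close> of the low-rank objective is exactly what is missing from
  \<open>2 \<parallel>A\<parallel>\<^sup>2 - 4 \<langle>A, L\<^sup>T \<Pi> Z\<rangle>\<close> to make a square; all the other terms agree.
\<close>

lemma joint_objective_complete_square:
  fixes L :: "real^'r::finite^('m::finite \<times> 'n::finite)" and z :: "'n \<Rightarrow> real^'d::finite"
  assumes "\<pi> \<in> plans"
  shows "joint_objective L z \<epsilon> A \<pi> =
    lowrank_objective L z \<epsilon> \<pi> + 2 * (norm (A - latent L z \<pi>))\<^sup>2"
proof -
  have "(norm (A - latent L z \<pi>))\<^sup>2
      = (norm A)\<^sup>2 - 2 * (A \<bullet> latent L z \<pi>) + (norm (latent L z \<pi>))\<^sup>2"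
    by (simp add: power2_norm_eq_inner inner_diff_left inner_diff_right inner_commute)
  then show ?thesis
    by (simp add: joint_objective_def ot_objective_def sum.distrib sum_row_block_inner
        inner_cost_matrix lowrank_objective_stack quadratic_cost[OF assms]
        sum_distrib_left[symmetric, where r = \<epsilon>])
qed

section \<open>Existence of optimal plans\<close>

lemma continuous_on_mult_ln: "continuous_on {0..} (\<lambda>t::real. t * ln t)"
proof -
  have "((\<lambda>t::real. t * ln t) \<longlongrightarrow> 0) (at_right 0)"
    by real_asymp
  then have "continuous (at 0 within {0..}) (\<lambda>t::real. t * ln t)"
    by (simp add: continuous_within at_within_Ici_at_right)
  moreover have "continuous (at t within {0..}) (\<lambda>t::real. t * ln t)" if "t > 0" for t
    using that by (intro continuous_intros) auto
  ultimately show ?thesis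
    by (auto simp: continuous_on_eq_continuous_within less_le)
qed

text \<open>
  The reference coupling has the constant entry \<open>1/n\<^sup>2\<close>, so with \<open>t = n\<^sup>2 P\<^sub>k\<^sub>l\<close> each entry
  contributes \<open>t ln t / n\<^sup>2\<close>, which is continuous up to \<open>t = 0\<close>.
\<close>

lemma continuous_on_kl_div_product: "continuous_on couplings (\<lambda>P. kl_div P product_coupling)"
proof -
  let ?n2 = "(real CARD('a))\<^sup>2"
  have "continuous_on couplings
      (\<lambda>P::real^'a^'a. \<Sum>k\<in>UNIV. \<Sum>l\<in>UNIV. (P $ k $ l * ?n2) * ln (P $ k $ l * ?n2) / ?n2)"
    by (intro continuous_intros continuous_on_compose2[OF continuous_on_mult_ln])
      (auto simp: couplings_def)
  moreover have "kl_div P product_coupling =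
      (\<Sum>k\<in>UNIV. \<Sum>l\<in>UNIV. (P $ k $ l * ?n2) * ln (P $ k $ l * ?n2) / ?n2)"
    if "P \<in> couplings" for P :: "real^'a^'a"
    using that by (subst kl_div_eq) (auto simp: couplings_def product_coupling_def)
  ultimately show ?thesis
    by (simp cong: continuous_on_cong)
qed

lemma compact_couplings: "compact (couplings :: (real^'n::finite^'n) set)"
proof -
  have "closed (couplings :: (real^'n^'n) set)"
    unfolding couplings_def
    by (intro closed_Collect_conj closed_Collect_all closed_Collect_le closed_Collect_eq
        continuous_intros)
  moreover have "bounded (couplings :: (real^'n^'n) set)"
  proof (rule bounded_subset)
    show "couplings \<subseteq> cbox (0 :: real^'n^'n) (\<chi> k l. 1 / real CARD('n))"
    proof
      fix P :: "real^'n^'n" assume P: "P \<in> couplings"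
      have "P $ k $ l \<le> 1 / real CARD('n)" for k l
        using member_le_sum[of l UNIV "\<lambda>l. P $ k $ l"] P by (auto simp: couplings_def)
      then show "P \<in> cbox 0 (\<chi> k l. 1 / real CARD('n))"
        using P by (auto simp: couplings_def cbox_interval less_eq_vec_def)
    qed
  qed simp
  ultimately show ?thesis by (simp add: compact_eq_bounded_closed)
qed

lemma product_coupling_in_couplings: "product_coupling \<in> couplings"
  by (simp add: product_coupling_def couplings_def power2_eq_square)

text \<open>
  Tychonoff for finitely many copies of the couplings; the topology on functions is the product
  topology.
\<close>

lemma compact_plans: "compact (plans :: ('m::finite \<Rightarrow> real^'n::finite^'n) set)"
proof -
  have "compactin (product_topology (\<lambda>i::'m. euclidean) UNIV)
      (PiE UNIV (\<lambda>i. couplings :: (real^'n^'n) set))"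
    by (simp add: compactin_PiE compact_couplings)
  moreover have "PiE UNIV (\<lambda>i. couplings) = (plans :: ('m \<Rightarrow> real^'n^'n) set)"
    by (auto simp: plans_def PiE_def)
  ultimately show ?thesis
    by (simp add: euclidean_product_topology)
qed

lemma has_minimum_INF:
  fixes f :: "'a::topological_space \<Rightarrow> real"
  assumes "compact S" "S \<noteq> {}" "continuous_on S f"
  shows "has_minimum f S (INF a\<in>S. f a)"
proof -
  obtain a where a: "a \<in> S" "\<And>b. b \<in> S \<Longrightarrow> f a \<le> f b"
    using continuous_attains_inf[OF assms] by blast
  then have "(INF a\<in>S. f a) = f a"
    by (intro cInf_eq_minimum) auto
  with a show ?thesis by (auto simp: has_minimum_def)
qed

lemma has_minimum_OT: "has_minimum (ot_objective C \<epsilon>) couplings (OT C \<epsilon>)"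
  unfolding OT_def
proof (rule has_minimum_INF[OF compact_couplings])
  show "continuous_on couplings (ot_objective C \<epsilon>)"
    unfolding ot_objective_def by (intro continuous_intros continuous_on_kl_div_product)
qed (use product_coupling_in_couplings in blast)

lemma has_minimum_lowrank_S:
  fixes L :: "real^'r::finite^('m::finite \<times> 'n::finite)" and z :: "'n \<Rightarrow> real^'d::finite"
  shows "has_minimum (lowrank_objective L z \<epsilon>) plans (lowrank_S L z \<epsilon>)"
  unfolding lowrank_S_def
proof (rule has_minimum_INF[OF compact_plans])
  show "(plans :: ('m \<Rightarrow> real^'n^'n) set) \<noteq> {}"
    using product_coupling_in_couplings by (auto simp: plans_def)
  have coord: "continuous_on plans (\<lambda>\<pi> :: 'm \<Rightarrow> real^'n^'n. \<pi> i)" for i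
    by (rule continuous_on_product_coordinates[THEN continuous_on_subset]) simp
  have "continuous_on plans (\<lambda>\<pi> :: 'm \<Rightarrow> real^'n^'n. kl_div (\<pi> i) product_coupling)" for i
    by (rule continuous_on_compose2[OF continuous_on_kl_div_product coord]) (auto simp: plans_def)
  then show "continuous_on plans (lowrank_objective L z \<epsilon>)"
    unfolding lowrank_objective_def by (intro continuous_intros coord)
qed

section \<open>Exchanging the two minimisations\<close>

text \<open>
  For fixed \<open>A\<close> the plans no longer interact, so a minimiser is obtained by choosing an optimal
  plan for each modality separately.
\<close>

lemma has_minimum_joint_objective:
  fixes L :: "real^'r::finite^('m::finite \<times> 'n::finite)" and z :: "'n \<Rightarrow> real^'d::finite"
  shows "has_minimum (joint_objective L z \<epsilon> A) plans
    (2 * (norm A)\<^sup>2 + (\<Sum>i\<in>UNIV. OT (row_block (cost_matrix L z A) i) \<epsilon>))"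
proof -
  let ?f = "\<lambda>i. ot_objective (row_block (cost_matrix L z A) i) \<epsilon>"
  let ?m = "\<lambda>i. OT (row_block (cost_matrix L z A) i) \<epsilon>"
  have min: "has_minimum (?f i) couplings (?m i)" for i
    by (rule has_minimum_OT)
  then have "\<exists>P\<in>couplings. ?f i P = ?m i" for i
    by (simp add: has_minimum_def)
  then obtain \<pi> where \<pi>: "\<And>i. \<pi> i \<in> couplings" "\<And>i. ?f i (\<pi> i) = ?m i"
    by metis
  have "(\<Sum>i\<in>UNIV. ?m i) \<le> (\<Sum>i\<in>UNIV. ?f i (\<pi>' i))" if "\<pi>' \<in> plans" for \<pi>'
    using min that by (intro sum_mono) (simp add: has_minimum_def plans_def)
  moreover have "\<pi> \<in> plans" and "joint_objective L z \<epsilon> A \<pi> = 2 * (norm A)\<^sup>2 + (\<Sum>i\<in>UNIV. ?m i)"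
    using \<pi> by (simp_all add: plans_def joint_objective_def)
  ultimately show ?thesis
    unfolding has_minimum_def by (auto simp: joint_objective_def)
qed

text \<open>
  The value at any \<open>A\<close> is the joint objective at some plans, and the joint objective dominates the
  low-rank objective because the completed square is nonnegative. Equality holds at the latent matrix of optimal plans, where the square
  vanishes.
\<close>

lemma has_minimum_latent_formulation:
  fixes L :: "real^'r::finite^('m::finite \<times> 'n::finite)" and z :: "'n \<Rightarrow> real^'d::finite"
  shows "has_minimum (\<lambda>A. 2 * (norm A)\<^sup>2 + (\<Sum>i\<in>UNIV. OT (row_block (cost_matrix L z A) i) \<epsilon>))
    UNIV (lowrank_S L z \<epsilon>)"
proof -
  let ?g = "\<lambda>A. 2 * (norm A)\<^sup>2 + (\<Sum>i\<in>UNIV. OT (row_block (cost_matrix L z A) i) \<epsilon>)"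
  have S: "\<And>\<pi>. \<pi> \<in> plans \<Longrightarrow> lowrank_S L z \<epsilon> \<le> lowrank_objective L z \<epsilon> \<pi>"
    using has_minimum_lowrank_S by (auto simp: has_minimum_def)
  have lower: "lowrank_S L z \<epsilon> \<le> ?g A" for A
  proof -
    obtain \<pi> where \<pi>: "\<pi> \<in> plans" "joint_objective L z \<epsilon> A \<pi> = ?g A"
      using has_minimum_joint_objective[of L z \<epsilon> A] by (auto simp: has_minimum_def)
    have "lowrank_S L z \<epsilon> \<le> lowrank_objective L z \<epsilon> \<pi>" by (rule S[OF \<pi>(1)])
    also have "\<dots> \<le> joint_objective L z \<epsilon> A \<pi>"
      by (simp add: joint_objective_complete_square[OF \<pi>(1)])
    finally show ?thesis using \<pi>(2) by simp
  qed
  obtain \<pi> where \<pi>: "\<pi> \<in> plans" "lowrank_objective L z \<epsilon> \<pi> = lowrank_S L z \<epsilon>"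
    using has_minimum_lowrank_S[of L z \<epsilon>] by (auto simp: has_minimum_def)
  have "?g (latent L z \<pi>) \<le> joint_objective L z \<epsilon> (latent L z \<pi>) \<pi>"
    using has_minimum_joint_objective[of L z \<epsilon> "latent L z \<pi>"] \<pi>(1) by (simp add: has_minimum_def)
  also have "\<dots> = lowrank_S L z \<epsilon>"
    by (simp add: joint_objective_complete_square[OF \<pi>(1)] \<pi>(2))
  finally have "?g (latent L z \<pi>) = lowrank_S L z \<epsilon>"
    using lower by (rule antisym)
  with lower show ?thesis unfolding has_minimum_def by blast
qed

lemma is_arg_min_joint_objective:
  fixes L :: "real^'r::finite^('m::finite \<times> 'n::finite)" and z :: "'n \<Rightarrow> real^'d::finite"
  assumes "\<pi> \<in> plans"
  shows "is_arg_min (\<lambda>A. joint_objective L z \<epsilon> A \<pi>) (\<lambda>_. True) A \<longleftrightarrow> A = latent L z \<pi>"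
proof
  assume "is_arg_min (\<lambda>A. joint_objective L z \<epsilon> A \<pi>) (\<lambda>_. True) A"
  then have "joint_objective L z \<epsilon> A \<pi> \<le> joint_objective L z \<epsilon> (latent L z \<pi>) \<pi>"
    by (simp add: is_arg_min_linorder)
  then show "A = latent L z \<pi>"
    by (simp add: joint_objective_complete_square[OF assms])
next
  assume "A = latent L z \<pi>"
  then show "is_arg_min (\<lambda>A. joint_objective L z \<epsilon> A \<pi>) (\<lambda>_. True) A"
    by (simp add: is_arg_min_linorder joint_objective_complete_square[OF assms])
qed

theorem theorem7:
  fixes dim :: "'m::finite \<Rightarrow> nat"
    and X :: "'m \<Rightarrow> (nat \<Rightarrow> real) set"
    and \<mu> :: "'m \<Rightarrow> (nat \<Rightarrow> real) measure"
    and K :: "'m point \<Rightarrow> 'm point \<Rightarrow> real"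
    and x :: "'m \<Rightarrow> 'n::finite \<Rightarrow> nat \<Rightarrow> real"
    and Z :: "(real^'d::finite) set"
    and z :: "'n \<Rightarrow> real^'d"
    and L :: "real^'r::finite^('m \<times> 'n)"
    and \<epsilon> :: real
  assumes "\<And>i. feature_space (dim i) (X i)"
    and "\<And>i. distribution_on (dim i) (X i) (\<mu> i)"
    and "kernel_assumption X \<mu> K"
    and "\<And>i k. x i k \<in> X i"
    and "\<And>l. z l \<in> Z"
    and "pivoted_cholesky_factor (kernel_matrix K x) L"
    and "\<epsilon> > 0"
  shows "has_minimum (lowrank_objective L z \<epsilon>) plans (lowrank_S L z \<epsilon>)
    \<and> (\<forall>A i. has_minimum (ot_objective (row_block (cost_matrix L z A) i) \<epsilon>) couplings
                         (OT (row_block (cost_matrix L z A) i) \<epsilon>))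
    \<and> has_minimum (\<lambda>A. 2 * (norm A)\<^sup>2 + (\<Sum>i\<in>UNIV. OT (row_block (cost_matrix L z A) i) \<epsilon>)) UNIV
                  (lowrank_S L z \<epsilon>)
    \<and> (\<forall>\<pi>\<in>plans. \<forall>A.
         is_arg_min (\<lambda>A. 2 * (norm A)\<^sup>2 +
             (\<Sum>i\<in>UNIV. row_block (cost_matrix L z A) i \<bullet> \<pi> i
                          + \<epsilon> * kl_div (\<pi> i) product_coupling)) (\<lambda>_. True) A
         \<longleftrightarrow> A = transpose L ** stack \<pi> ** Zhat z)"
  using has_minimum_lowrank_S[of L z \<epsilon>] has_minimum_OT has_minimum_latent_formulation[of L z \<epsilon>]
    is_arg_min_joint_objective[of _ L z \<epsilon>]
  unfolding joint_objective_def ot_objective_def latent_def by blast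

end
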